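(* Let $\mathbb{K}$ be a field. Every $4$-net $\lambda=(\lambda_1,\lambda_2,\lambda_3,\lambda_4)$ embedded in $PG(2,\mathbb{K})$ has constant cross-ratio; that is, the cross-ratio $(\ell_1,\ell_2,\ell_3,\ell_4)$ of the four lines $\ell_i\in\lambda_i$ ($i=1,2,3,4$) passing through a point $P$ of $\lambda$ is the same for every point $P$ of $\lambda$.
   Context: $PG(2,\mathbb{K})$ is the projective plane over the field $\mathbb{K}$. For $k\geq 3$, a $k$-net of order $n$ embedded in $PG(2,\mathbb{K})$ is a $k$-tuple $\lambda=(\lambda_1,\ldots,\lambda_k)$ of pairwise disjoint sets of lines of $PG(2,\mathbb{K})$ (called components), each of the same size $n$ (a positive integer), such that any two lines from distinct components are concurrent with exactly one line from each component: if $\ell\in\lambda_i$, $m\in\lambda_j$ with $i\neq j$, then through the point $\ell\cap m$ there passes exactly one line of each of $\lambda_1,\ldots,\lambda_k$. The points of the net $\lambda$ are the $n^2$ points $\ell\cap m$ of this kind. Cross-ratio of four distinct concurrent lines $\ell_1,\ell_2,\ell_3,\ell_4$: choose linear forms $r,w$ such that $\ell_1,\ell_2,\ell_3$ have equations $r=0$, $w=0$, $r+w=0$; then $(\ell_1,\ell_2,\ell_3,\ell_4)$ is the unique $\kappa\in\mathbb{K}\setminus\{0,1\}$ such that $\ell_4$ has equation $\kappa r+w=0$. *)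

theory Defs
  imports "HOL-Analysis.Analysis"
begin

text \<open>The points and lines of the projective plane over a field \<open>'k\<close> are the one- and
  two-dimensional subspaces of \<open>'k ^ 3\<close>; incidence is inclusion. In particular the point of
  intersection of two distinct lines is literally their set-theoretic intersection.\<close>

definition pg_points :: "('k::field ^ 3) set set" where
  "pg_points = {P. vec.subspace P \<and> vec.dim P = 1}"

definition pg_lines :: "('k::field ^ 3) set set" where
  "pg_lines = {l. vec.subspace l \<and> vec.dim l = 2}"

text \<open>The \<open>k\<close>-tuple of components is a function on \<open>nat\<close> of which only the values at
  \<open>1, \<dots>, k\<close> matter.\<close>

definition is_net :: "nat \<Rightarrow> nat \<Rightarrow> (nat \<Rightarrow> ('k::field ^ 3) set set) \<Rightarrow> bool" where
  "is_net k n \<Lambda> \<longleftrightarrow>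
     3 \<le> k \<and> 0 < n \<and>
     (\<forall>i\<in>{1..k}. \<Lambda> i \<subseteq> pg_lines \<and> finite (\<Lambda> i) \<and> card (\<Lambda> i) = n) \<and>
     disjoint_family_on \<Lambda> {1..k} \<and>
     (\<forall>i\<in>{1..k}. \<forall>j\<in>{1..k}. i \<noteq> j \<longrightarrow>
        (\<forall>l\<in>\<Lambda> i. \<forall>m\<in>\<Lambda> j. \<forall>h\<in>{1..k}. \<exists>!t. t \<in> \<Lambda> h \<and> l \<inter> m \<subseteq> t))"

definition net_points :: "nat \<Rightarrow> (nat \<Rightarrow> ('k::field ^ 3) set set) \<Rightarrow> ('k ^ 3) set set" where
  "net_points k \<Lambda> =
     {P. \<exists>i\<in>{1..k}. \<exists>j\<in>{1..k}. i \<noteq> j \<and> (\<exists>l\<in>\<Lambda> i. \<exists>m\<in>\<Lambda> j. P = l \<inter> m)}"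

abbreviation linear_form :: "('k::field ^ 3 \<Rightarrow> 'k) \<Rightarrow> bool" where
  "linear_form \<equiv> Vector_Spaces.linear (*s) (*)"

definition has_cross_ratio ::
  "('k::field ^ 3) set \<Rightarrow> ('k ^ 3) set \<Rightarrow> ('k ^ 3) set \<Rightarrow> ('k ^ 3) set \<Rightarrow> 'k \<Rightarrow> bool" where
  "has_cross_ratio l1 l2 l3 l4 \<kappa> \<longleftrightarrow>
     \<kappa> \<noteq> 0 \<and> \<kappa> \<noteq> 1 \<and>
     (\<exists>r w. linear_form r \<and> linear_form w \<and>
        l1 = {x. r x = 0} \<and> l2 = {x. w x = 0} \<and> l3 = {x. r x + w x = 0} \<and>
        l4 = {x. \<kappa> * r x + w x = 0})"

text \<open>Meaningful only for four distinct concurrent lines; see \<open>cross_ratio_exists_unique\<close>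
  below.\<close>

definition cross_ratio ::
  "('k::field ^ 3) set \<Rightarrow> ('k ^ 3) set \<Rightarrow> ('k ^ 3) set \<Rightarrow> ('k ^ 3) set \<Rightarrow> 'k" where
  "cross_ratio l1 l2 l3 l4 = (THE \<kappa>. has_cross_ratio l1 l2 l3 l4 \<kappa>)"

lemma inter_lines_in_pg_points:
  fixes l m :: "('k::field ^ 3) set"
  assumes l: "l \<in> pg_lines" and m: "m \<in> pg_lines" and ne: "l \<noteq> m"
  shows "l \<inter> m \<in> pg_points"
proof -
  have s: "vec.subspace l" "vec.subspace m" and d: "vec.dim l = 2" "vec.dim m = 2"
    using l m by (auto simp: pg_lines_def)
  let ?S = "{x + y |x y. x \<in> l \<and> y \<in> m}"
  have sub: "vec.subspace (l \<inter> m)"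
    using s by (rule vec.subspace_inter)
  have "vec.dim ?S + vec.dim (l \<inter> m) = 4"
    using vec.dim_sums_Int[OF s] d by simp
  moreover have "vec.dim ?S \<le> 3"
    using vec.dim_subset_UNIV[of ?S] by (simp add: vec.dimension_def card_cart_basis)
  moreover have "vec.dim (l \<inter> m) \<noteq> 2"
  proof
    assume "vec.dim (l \<inter> m) = 2"
    then have "l \<inter> m = l" "l \<inter> m = m"
      using vec.subspace_dim_equal[OF sub s(1)] vec.subspace_dim_equal[OF sub s(2)] d by auto
    with ne show False by simp
  qed
  moreover have "vec.dim (l \<inter> m) \<le> 2"
    using vec.dim_subset[of "l \<inter> m" l] d by simp
  ultimately show ?thesis
    using sub by (simp add: pg_points_def)
qed

lemma line_equation:
  fixes l :: "('k::field ^ 3) set"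
  assumes "l \<in> pg_lines"
  obtains r where "linear_form r" "l = {x. r x = 0}"
proof -
  have s: "vec.subspace l" and d: "vec.dim l = 2"
    using assms by (auto simp: pg_lines_def)
  interpret p: vector_space_pair "(*s) :: 'k \<Rightarrow> 'k ^ 3 \<Rightarrow> 'k ^ 3" "(*) :: 'k \<Rightarrow> 'k \<Rightarrow> 'k"
    by unfold_locales
  obtain B where B: "B \<subseteq> l" "vec.independent B" "l \<subseteq> vec.span B"
    using vec.basis_exists by metis
  obtain C where C: "B \<subseteq> C" "vec.independent C" "UNIV \<subseteq> vec.span C"
    using vec.maximal_independent_subset_extend[OF subset_UNIV B(2)] by metis
  obtain r where r: "linear_form r" "\<forall>x\<in>C. r x = (if x \<in> B then 0 else 1)"
    using p.linear_independent_extend[OF C(2), of "\<lambda>x. if x \<in> B then 0 else 1"] by blast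
  interpret r: Vector_Spaces.linear "(*s)" "(*)" r by (rule r)
  have k: "vec.subspace {x. r x = 0}"
    by (rule vec.subspaceI) (auto simp: r.zero r.add r.scale)
  have le: "l \<subseteq> {x. r x = 0}"
  proof -
    have "B \<subseteq> {x. r x = 0}" using r(2) C(1) by auto
    then show ?thesis using B(3) vec.span_minimal[OF _ k] by blast
  qed
  have "vec.dim {x. r x = 0} \<le> 2"
  proof (rule ccontr)
    assume "\<not> ?thesis"
    then have "vec.dim {x. r x = 0} \<ge> vec.dim (UNIV :: ('k ^ 3) set)" by (simp add: card_cart_basis)
    then have "{x. r x = 0} = UNIV"
      using vec.subspace_dim_equal[OF k, of UNIV] by auto
    then have "C \<subseteq> B" using r(2) by (metis (mono_tags, lifting) UNIV_I mem_Collect_eq subsetI zero_neq_one)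
    then have "UNIV \<subseteq> l" using C(3) vec.span_mono[of C B] vec.span_minimal[OF B(1) s] by blast
    then have "l = UNIV" by auto
    with d have "vec.dim (UNIV :: ('k ^ 3) set) = 2" by metis
    then show False by (simp add: card_cart_basis)
  qed
  then have "l = {x. r x = 0}"
    using vec.subspace_dim_equal[OF s k le] d by simp
  with r(1) that show ?thesis by blast
qed

lemma line_not_subset:
  fixes l m :: "('k::field ^ 3) set"
  assumes "l \<in> pg_lines" "m \<in> pg_lines" "l \<noteq> m"
  shows "\<not> l \<subseteq> m"
  using assms vec.subspace_dim_equal[of l m] by (auto simp: pg_lines_def)

lemma dual_points:
  fixes l m :: "('k::field ^ 3) set"
  assumes l: "l \<in> pg_lines" and m: "m \<in> pg_lines" and ne: "l \<noteq> m"
    and r: "linear_form r" "l = {x. r x = 0}" and w: "linear_form w" "m = {x. w x = 0}"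
  obtains a b where "r a = 1" "w a = 0" "r b = 0" "w b = 1"
proof -
  interpret r: Vector_Spaces.linear "(*s)" "(*)" r by (rule r)
  interpret w: Vector_Spaces.linear "(*s)" "(*)" w by (rule w)
  obtain a where a: "r a \<noteq> 0" "w a = 0"
    using line_not_subset[OF m l] ne r(2) w(2) by auto
  obtain b where b: "w b \<noteq> 0" "r b = 0"
    using line_not_subset[OF l m] ne r(2) w(2) by auto
  show ?thesis
    using a b by (intro that[of "inverse (r a) *s a" "inverse (w b) *s b"])
      (simp_all add: r.scale w.scale)
qed

lemma cross_ratio_exists_unique:
  fixes l1 l2 l3 l4 :: "('k::field ^ 3) set"
  assumes lines: "l1 \<in> pg_lines" "l2 \<in> pg_lines" "l3 \<in> pg_lines" "l4 \<in> pg_lines"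
    and distinct: "distinct [l1, l2, l3, l4]"
    and P: "P \<in> pg_points" "P \<subseteq> l1" "P \<subseteq> l2" "P \<subseteq> l3" "P \<subseteq> l4"
  shows "\<exists>!\<kappa>. has_cross_ratio l1 l2 l3 l4 \<kappa>"
proof -
  have "l1 \<inter> l2 \<in> pg_points"
    using inter_lines_in_pg_points lines distinct by auto
  then have conc: "l1 \<inter> l2 = P"
    using P vec.subspace_dim_equal[of P "l1 \<inter> l2"] by (auto simp: pg_points_def)
  obtain r where r: "linear_form r" "l1 = {x. r x = 0}" using line_equation lines(1) .
  obtain w where w: "linear_form w" "l2 = {x. w x = 0}" using line_equation lines(2) .
  interpret r: Vector_Spaces.linear "(*s)" "(*)" r by (rule r)
  interpret w: Vector_Spaces.linear "(*s)" "(*)" w by (rule w)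
  obtain a b where ab: "r a = 1" "w a = 0" "r b = 0" "w b = 1"
    using dual_points[OF lines(1,2) _ r w] distinct by auto
  have comb: "f x = r x * f a + w x * f b"
    if f: "linear_form f" "l = {x. f x = 0}" "P \<subseteq> l" for f x l
  proof -
    interpret f: Vector_Spaces.linear "(*s)" "(*)" f by (rule f)
    let ?y = "x - r x *s a - w x *s b"
    have "?y \<in> l1 \<inter> l2" unfolding r(2) w(2)
      using ab by (simp add: r.diff w.diff r.scale w.scale)
    then have "f ?y = 0" using conc f by auto
    then have "f x - r x * f a - w x * f b = 0" by (simp only: f.diff f.scale)
    then show ?thesis by (simp only: diff_diff_eq right_minus_eq)
  qed
  have nz: "f a \<noteq> 0 \<and> f b \<noteq> 0"
    if f: "linear_form f" "l = {x. f x = 0}" "P \<subseteq> l" "l \<in> pg_lines" "l \<noteq> l1" "l \<noteq> l2" for f l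
  proof -
    have 1: "\<not> l1 \<subseteq> l" "\<not> l2 \<subseteq> l"
      using line_not_subset lines f by metis+
    then obtain x y where "r x = 0" "f x \<noteq> 0" "w y = 0" "f y \<noteq> 0"
      using r w f(2) by blast
    then show ?thesis using comb[OF f(1-3), of x] comb[OF f(1-3), of y] by auto
  qed
  obtain f where f: "linear_form f" "l3 = {x. f x = 0}" using line_equation lines(3) .
  obtain g where g: "linear_form g" "l4 = {x. g x = 0}" using line_equation lines(4) .
  have fz: "f a \<noteq> 0" "f b \<noteq> 0" and gz: "g a \<noteq> 0" "g b \<noteq> 0"
    using nz[OF f P(4) lines(3)] nz[OF g P(5) lines(4)] distinct by auto
  define \<kappa> where "\<kappa> = g a * f b / (g b * f a)"
  define r' where "r' = (\<lambda>x. f a * r x)"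
  define w' where "w' = (\<lambda>x. f b * w x)"
  have lin: "linear_form r'" "linear_form w'"
    unfolding r'_def w'_def
    by (unfold_locales; simp add: r.add w.add r.scale w.scale algebra_simps)+
  have e3: "l3 = {x. r' x + w' x = 0}"
  proof -
    have "f x = r' x + w' x" for x
      unfolding r'_def w'_def comb[OF f P(4), of x] by (simp only: mult.commute)
    then show ?thesis unfolding f(2) by simp
  qed
  have "\<kappa> * r' x + w' x = (f b / g b) * g x" for x
    unfolding comb[OF g P(5), of x] using gz fz by (simp add: \<kappa>_def r'_def w'_def field_simps)
  then have e4: "l4 = {x. \<kappa> * r' x + w' x = 0}"
    unfolding g(2) using gz fz by simp
  have "\<kappa> \<noteq> 1" using e3 e4 distinct by auto
  moreover have "\<kappa> \<noteq> 0" using fz gz by (simp add: \<kappa>_def)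
  moreover have "l1 = {x. r' x = 0}" "l2 = {x. w' x = 0}"
    using r w fz by (auto simp: r'_def w'_def)
  ultimately have ex: "has_cross_ratio l1 l2 l3 l4 \<kappa>"
    unfolding has_cross_ratio_def using lin e3 e4 by blast
  have un: "\<mu> = \<nu>" if m: "has_cross_ratio l1 l2 l3 l4 \<mu>" and n: "has_cross_ratio l1 l2 l3 l4 \<nu>" for \<mu> \<nu>
  proof -
    obtain r w where r: "linear_form r" "l1 = {x. r x = 0}" and w: "linear_form w" "l2 = {x. w x = 0}"
      and m3: "l3 = {x. r x + w x = 0}" and m4: "l4 = {x. \<mu> * r x + w x = 0}"
      using m unfolding has_cross_ratio_def by blast
    obtain r' w' where r': "linear_form r'" "l1 = {x. r' x = 0}"
      and w': "linear_form w'" "l2 = {x. w' x = 0}"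
      and n3: "l3 = {x. r' x + w' x = 0}" and n4: "l4 = {x. \<nu> * r' x + w' x = 0}"
      using n unfolding has_cross_ratio_def by blast
    interpret r: Vector_Spaces.linear "(*s)" "(*)" r by (rule r)
    interpret w: Vector_Spaces.linear "(*s)" "(*)" w by (rule w)
    interpret r': Vector_Spaces.linear "(*s)" "(*)" r' by (rule r')
    interpret w': Vector_Spaces.linear "(*s)" "(*)" w' by (rule w')
    obtain a b where ab: "r a = 1" "w a = 0" "r b = 0" "w b = 1"
      using dual_points[OF lines(1,2) _ r w] distinct by auto
    have wa: "w' a = 0" and rb: "r' b = 0" and ra: "r' a \<noteq> 0"
    proof -
      have "a \<in> l2" "b \<in> l1" using ab r(2) w(2) by auto
      then show "w' a = 0" "r' b = 0" using r'(2) w'(2) by auto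
      have "a \<notin> l1" using ab r(2) by auto
      then show "r' a \<noteq> 0" using r'(2) by auto
    qed
    have "a - b \<in> l3" unfolding m3 using ab by (simp add: r.diff w.diff)
    then have c: "r' a = w' b" unfolding n3 using wa rb by (simp add: r'.diff w'.diff)
    have "a - \<mu> *s b \<in> l4" unfolding m4 using ab by (simp add: r.diff w.diff r.scale w.scale)
    then have "\<nu> * r' a - \<mu> * w' b = 0"
      unfolding n4 using wa rb by (simp add: r'.diff w'.diff r'.scale w'.scale)
    with c ra show ?thesis by simp
  qed
  show ?thesis using ex un by blast
qed

end

theory Submission
  imports Defs
begin

text \<open>Let \<open>F\<^sub>i\<close> be the product of linear forms defining the lines of \<open>\<Lambda> i\<close>. Restricted to a line
  \<open>l\<close> of \<open>\<Lambda> i\<close>, the forms of \<open>\<Lambda> j\<close> and of \<open>\<Lambda> h\<close> are proportional in pairs, because the lines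
  of both components cut \<open>l\<close> in the same points; so \<open>F\<^sub>h = C F\<^sub>j\<close> on \<open>l\<close>. The factor \<open>C\<close> does
  not depend on \<open>l\<close>: two lines of \<open>\<Lambda> i\<close> meet in a point at which \<open>F\<^sub>j\<close> does not vanish.
  Differentiating these relations at a net point, along the lines of \<open>\<Lambda> 1\<close> and \<open>\<Lambda> 2\<close> through it,
  expresses the cross-ratio by the four constants with \<open>{i, j} = {1, 2}\<close> and \<open>h \<in> {3, 4}\<close>.\<close>

section \<open>Linear forms of lines, and points spanned by a vector\<close>

text \<open>A line determines its form only up to a nonzero factor. Fixing one choice per line makes
  the products over a component actual functions; the proportionality constants below absorb the
  choice.\<close>

definition line_form :: "('k::field ^ 3) set \<Rightarrow> 'k ^ 3 \<Rightarrow> 'k" where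
  "line_form l = (SOME r. linear_form r \<and> l = {x. r x = 0})"

lemma line_form:
  assumes "l \<in> pg_lines"
  shows linear_line_form: "linear_form (line_form l)"
    and line_form_eq: "l = {x. line_form l x = 0}"
proof -
  have "\<exists>r. linear_form r \<and> l = {x. r x = 0}"
    using line_equation[OF assms] by metis
  from someI_ex[OF this] show "linear_form (line_form l)" "l = {x. line_form l x = 0}"
    unfolding line_form_def by auto
qed

lemma line_form_eq_0_iff: "l \<in> pg_lines \<Longrightarrow> line_form l x = 0 \<longleftrightarrow> x \<in> l"
  using line_form_eq by blast

text \<open>On the two-dimensional space \<open>l\<close> both forms vanish on the one-dimensional
  \<open>l \<inter> m\<close>, so one is a multiple of the other; \<open>t \<noteq> l\<close>
  excludes the factor zero.\<close>

lemma line_form_proportional: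
  assumes l: "l \<in> pg_lines" and m: "m \<in> pg_lines" and t: "t \<in> pg_lines"
    and "l \<noteq> m" "t \<noteq> l" and sub: "l \<inter> m \<subseteq> t"
  shows "\<exists>c. c \<noteq> 0 \<and> (\<forall>x\<in>l. line_form t x = c * line_form m x)"
proof -
  interpret m: Vector_Spaces.linear "(*s)" "(*)" "line_form m" by (rule linear_line_form[OF m])
  interpret t: Vector_Spaces.linear "(*s)" "(*)" "line_form t" by (rule linear_line_form[OF t])
  interpret l: Vector_Spaces.linear "(*s)" "(*)" "line_form l" by (rule linear_line_form[OF l])
  \<comment> \<open>With this normalisation, subtracting \<open>line_form m x *s b\<close> moves any
    \<open>x\<close> of \<open>l\<close> into \<open>l \<inter> m\<close>, so the factor has to be
    \<open>line_form t b\<close>.\<close>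
  obtain b where b: "line_form l b = 0" "line_form m b = 1"
    using dual_points[OF l m \<open>l \<noteq> m\<close> line_form[OF l] line_form[OF m]] by metis
  have eq: "line_form t x = line_form t b * line_form m x" if "x \<in> l" for x
  proof -
    have "x - line_form m x *s b \<in> l \<inter> m"
      using that b l m
      by (simp add: line_form_eq_0_iff[symmetric] l.diff l.scale m.diff m.scale)
    then have "line_form t (x - line_form m x *s b) = 0"
      using sub t by (auto simp: line_form_eq_0_iff)
    then show ?thesis by (simp add: t.diff t.scale mult.commute)
  qed
  moreover have "line_form t b \<noteq> 0"
  proof
    assume "line_form t b = 0"
    then have "l \<subseteq> t" using eq t by (auto simp: line_form_eq_0_iff[symmetric])
    then show False using line_not_subset[OF l t] \<open>t \<noteq> l\<close> by blast
  qed
  ultimately show ?thesis by blast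
qed

text \<open>A point is spanned by any of its nonzero vectors, so incidence can be tested on a single
  vector.\<close>

lemma point_subset_line:
  assumes "P \<in> pg_points" "l \<in> pg_lines" "x \<in> P" "x \<in> l" "x \<noteq> 0"
  shows "P \<subseteq> l"
proof -
  have s: "vec.subspace P" "vec.subspace (P \<inter> l)" and d: "vec.dim P = 1"
    using assms by (auto simp: pg_points_def pg_lines_def vec.subspace_inter)
  have "vec.dim {x} = 1"
    using assms(5) vec.dim_eq_card_independent[of "{x}"] by simp
  then have "1 \<le> vec.dim (P \<inter> l)"
    using vec.dim_subset[of "{x}" "P \<inter> l"] assms by simp
  then have "P \<inter> l = P"
    using vec.subspace_dim_equal[OF s(2,1)] d by simp
  then show ?thesis by blast
qed

lemma point_nonzero:
  assumes "P \<in> pg_points"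
  obtains x where "x \<in> P" "x \<noteq> 0"
proof -
  have "\<not> P \<subseteq> {0}"
    using assms vec.dim_subset[of P "{0}"] by (auto simp: pg_points_def)
  then show ?thesis using that by blast
qed

section \<open>Lines and points of a net\<close>

lemma net_component:
  assumes net: "is_net k n \<Lambda>" and i: "i \<in> {1..k}"
  shows "\<Lambda> i \<subseteq> pg_lines" "finite (\<Lambda> i)" "card (\<Lambda> i) = n" "\<Lambda> i \<noteq> {}"
proof -
  have "\<forall>i\<in>{1..k}. \<Lambda> i \<subseteq> pg_lines \<and> finite (\<Lambda> i) \<and> card (\<Lambda> i) = n"
    using net unfolding is_net_def by (elim conjE)
  moreover have "0 < n"
    using net unfolding is_net_def by (elim conjE)
  ultimately
  show "\<Lambda> i \<subseteq> pg_lines" "finite (\<Lambda> i)" "card (\<Lambda> i) = n" "\<Lambda> i \<noteq> {}" using i by (fastforce dest: bspec[OF _ i])+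
qed

lemma net_line: "is_net k n \<Lambda> \<Longrightarrow> i \<in> {1..k} \<Longrightarrow> l \<in> \<Lambda> i \<Longrightarrow> l \<in> pg_lines"
  using net_component(1) by (rule subsetD)

lemma net_lines_distinct:
  assumes net: "is_net k n \<Lambda>" and ij: "i \<in> {1..k}" "j \<in> {1..k}" "i \<noteq> j"
    and lm: "l \<in> \<Lambda> i" "m \<in> \<Lambda> j"
  shows "l \<noteq> m"
proof -
  have "disjoint_family_on \<Lambda> {1..k}"
    using net unfolding is_net_def by (elim conjE)
  from disjoint_family_onD[OF this ij] lm show ?thesis by blast
qed

lemma net_inter:
  assumes "is_net k n \<Lambda>" "i \<in> {1..k}" "j \<in> {1..k}" "i \<noteq> j" "l \<in> \<Lambda> i" "m \<in> \<Lambda> j"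
  shows "l \<inter> m \<in> pg_points"
  by (rule inter_lines_in_pg_points)
    (rule net_line[OF assms(1,2,5)] net_line[OF assms(1,3,6)] net_lines_distinct[OF assms])+

lemma net_unique_line:
  assumes net: "is_net k n \<Lambda>" and ij: "i \<in> {1..k}" "j \<in> {1..k}" "i \<noteq> j"
    and lm: "l \<in> \<Lambda> i" "m \<in> \<Lambda> j" and h: "h \<in> {1..k}"
  shows "\<exists>!t. t \<in> \<Lambda> h \<and> l \<inter> m \<subseteq> t"
proof -
  have "\<forall>i\<in>{1..k}. \<forall>j\<in>{1..k}. i \<noteq> j \<longrightarrow>
      (\<forall>l\<in>\<Lambda> i. \<forall>m\<in>\<Lambda> j. \<forall>h\<in>{1..k}. \<exists>!t. t \<in> \<Lambda> h \<and> l \<inter> m \<subseteq> t)"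
    using net unfolding is_net_def by (elim conjE)
  note mp[OF bspec[OF bspec[OF this ij(1)] ij(2)] ij(3)]
  from bspec[OF bspec[OF bspec[OF this lm(1)] lm(2)] h] show ?thesis .
qed

text \<open>The derivative in direction \<open>b\<close> of the product of the forms of \<open>L\<close>, at a point \<open>x\<close> of the
  line \<open>m\<close>; for \<open>b = x\<close> the product itself.\<close>

definition deriv_form ::
  "('k::field ^ 3) set set \<Rightarrow> ('k ^ 3) set \<Rightarrow> 'k ^ 3 \<Rightarrow> 'k ^ 3 \<Rightarrow> 'k" where
  "deriv_form L m b x = line_form m b * (\<Prod>s\<in>L - {m}. line_form s x)"

section \<open>Comparing two components along the lines of a third\<close>

text \<open>Each \<open>m\<close> is matched with the line \<open>\<sigma> m\<close> of
  \<open>\<Lambda> h\<close> through \<open>l \<inter> m\<close>, and matched forms are proportional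
  on \<open>l\<close>. Both \<open>b\<close> and \<open>x\<close> lie on \<open>l\<close>, so every
  factor contributes its constant, and the total is the same whichever pair is evaluated at
  \<open>b\<close>.\<close>

lemma deriv_form_proportional_on_line:
  assumes net: "is_net k n \<Lambda>" and ijh: "i \<in> {1..k}" "j \<in> {1..k}" "h \<in> {1..k}"
    and ne: "i \<noteq> j" "i \<noteq> h" "j \<noteq> h" and l: "l \<in> \<Lambda> i"
  shows "\<exists>C. C \<noteq> 0 \<and> (\<forall>m\<in>\<Lambda> j. \<forall>t\<in>\<Lambda> h. l \<inter> m \<subseteq> t \<longrightarrow>
           (\<forall>b\<in>l. \<forall>x\<in>l. deriv_form (\<Lambda> h) t b x = C * deriv_form (\<Lambda> j) m b x))"
proof -
  define \<sigma> where "\<sigma> m = (THE t. t \<in> \<Lambda> h \<and> l \<inter> m \<subseteq> t)" for m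
  have \<sigma>: "\<sigma> m \<in> \<Lambda> h \<and> l \<inter> m \<subseteq> \<sigma> m" if "m \<in> \<Lambda> j" for m
    unfolding \<sigma>_def using net_unique_line[OF net ijh(1,2) ne(1) l that ijh(3)] by (rule theI')
  have \<sigma>_eq: "\<sigma> m = t" if "m \<in> \<Lambda> j" "t \<in> \<Lambda> h" "l \<inter> m \<subseteq> t" for m t
    using net_unique_line[OF net ijh(1,2) ne(1) l that(1) ijh(3)] \<sigma>[OF that(1)] that by blast
  have lpg: "l \<in> pg_lines" using net_line[OF net ijh(1) l] .
  have ex: "\<exists>c. c \<noteq> 0 \<and> (\<forall>x\<in>l. line_form (\<sigma> m) x = c * line_form m x)" if m: "m \<in> \<Lambda> j" for m
  proof (rule line_form_proportional[OF lpg])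
    show "m \<in> pg_lines" "\<sigma> m \<in> pg_lines" "l \<inter> m \<subseteq> \<sigma> m"
      using net_line[OF net ijh(2) m] net_line[OF net ijh(3)] \<sigma>[OF m] by auto
    show "l \<noteq> m" using net_lines_distinct[OF net ijh(1,2) ne(1) l m] .
    show "\<sigma> m \<noteq> l" using net_lines_distinct[OF net ijh(1,3) ne(2) l] \<sigma>[OF m] by metis
  qed
  then obtain c where c: "\<And>m. m \<in> \<Lambda> j \<Longrightarrow> c m \<noteq> 0"
    "\<And>m x. m \<in> \<Lambda> j \<Longrightarrow> x \<in> l \<Longrightarrow> line_form (\<sigma> m) x = c m * line_form m x"
    by metis
  have inj: "inj_on \<sigma> (\<Lambda> j)"
  proof (rule inj_onI)
    fix m m' assume m: "m \<in> \<Lambda> j" "m' \<in> \<Lambda> j" and eq: "\<sigma> m = \<sigma> m'"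
    \<comment> \<open>As \<open>c m\<close> is nonzero, \<open>\<sigma> m\<close> determines the
      point \<open>l \<inter> m\<close>, and with it the only line of \<open>\<Lambda> j\<close>
      through that point.\<close>
    have "{x \<in> l. line_form (\<sigma> m) x = 0} = l \<inter> m" if "m \<in> \<Lambda> j" for m
      using c that net_line[OF net ijh(2) that] by (auto simp: line_form_eq_0_iff)
    then have "l \<inter> m = l \<inter> m'" using m eq by metis
    then show "m = m'"
      using net_unique_line[OF net ijh(1,2) ne(1) l m(1) ijh(2)] m by blast
  qed
  have surj: "\<sigma> ` \<Lambda> j = \<Lambda> h"
  proof
    show "\<sigma> ` \<Lambda> j \<subseteq> \<Lambda> h" using \<sigma> by blast
    show "\<Lambda> h \<subseteq> \<sigma> ` \<Lambda> j"
      using card_subset_eq[of "\<Lambda> h" "\<sigma> ` \<Lambda> j"] card_image[OF inj] \<open>\<sigma> ` \<Lambda> j \<subseteq> \<Lambda> h\<close>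
        net_component(2,3)[OF net ijh(3)] net_component(3)[OF net ijh(2)] by simp
  qed
  have "deriv_form (\<Lambda> h) t b x = prod c (\<Lambda> j) * deriv_form (\<Lambda> j) m b x"
    if m: "m \<in> \<Lambda> j" and t: "t \<in> \<Lambda> h" "l \<inter> m \<subseteq> t" and b: "b \<in> l" and x: "x \<in> l" for m t b x
  proof -
    have im: "\<Lambda> h - {t} = \<sigma> ` (\<Lambda> j - {m})"
      using inj_on_image_set_diff[OF inj, of "\<Lambda> j" "{m}"] \<sigma>_eq[OF m t] surj m by simp
    have "(\<Prod>s\<in>\<Lambda> h - {t}. line_form s x) = (\<Prod>s\<in>\<Lambda> j - {m}. line_form (\<sigma> s) x)"
      unfolding im using inj by (subst prod.reindex) (auto intro: inj_on_subset)
    also have "\<dots> = (\<Prod>s\<in>\<Lambda> j - {m}. c s * line_form s x)"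
      using c(2) x by (intro prod.cong) auto
    also have "\<dots> = prod c (\<Lambda> j - {m}) * (\<Prod>s\<in>\<Lambda> j - {m}. line_form s x)"
      by (rule prod.distrib)
    finally show ?thesis
      \<comment> \<open>The factor evaluated at \<open>b\<close> supplies the missing
        \<open>c m\<close>, completing the product of constants to all of
        \<open>\<Lambda> j\<close>.\<close>
      using c(2)[OF m b] \<sigma>_eq[OF m t] prod.remove[OF net_component(2)[OF net ijh(2)] m, of c]
      by (simp add: deriv_form_def mult_ac)
  qed
  moreover have "prod c (\<Lambda> j) \<noteq> 0"
    using c(1) net_component(2)[OF net ijh(2)] by simp
  ultimately show ?thesis by blast
qed

lemma net_line_through_point:
  assumes net: "is_net k n \<Lambda>" and ij: "i \<in> {1..k}" "j \<in> {1..k}" "i \<noteq> j"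
    and l: "l \<in> \<Lambda> i" and m: "m \<in> \<Lambda> j" and h: "h \<in> {1..k}"
    and x: "x \<in> l \<inter> m" "x \<noteq> 0" and st: "s \<in> \<Lambda> h" "t \<in> \<Lambda> h" "x \<in> s" "x \<in> t"
  shows "s = t"
proof -
  have "l \<inter> m \<subseteq> u" if "u \<in> \<Lambda> h" "x \<in> u" for u
    using point_subset_line[OF net_inter[OF net ij l m] net_line[OF net h]] that x by metis
  then show ?thesis
    using net_unique_line[OF net ij l m h] st by blast
qed

text \<open>Only one line of a component passes through a net point, so the product of the forms of
  \<open>\<Lambda> j\<close> has a simple zero at \<open>x\<close>, and its derivative vanishes only
  in the directions of \<open>m\<close>.\<close>

lemma deriv_form_nonzero:
  assumes net: "is_net k n \<Lambda>" and ij: "i \<in> {1..k}" "j \<in> {1..k}" "i \<noteq> j"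
    and l: "l \<in> \<Lambda> i" and m: "m \<in> \<Lambda> j" and x: "x \<in> l \<inter> m" "x \<noteq> 0" and b: "b \<notin> m"
  shows "deriv_form (\<Lambda> j) m b x \<noteq> 0"
proof -
  have "x \<notin> s" if "s \<in> \<Lambda> j - {m}" for s
    using net_line_through_point[OF net ij l m ij(2) x _ m] that x(1) by blast
  then show ?thesis
    using b m net_line[OF net ij(2)] net_component(2)[OF net ij(2)]
    by (simp add: deriv_form_def line_form_eq_0_iff)
qed

lemma deriv_form_proportional:
  assumes net: "is_net k n \<Lambda>" and ijh: "i \<in> {1..k}" "j \<in> {1..k}" "h \<in> {1..k}"
    and ne: "i \<noteq> j" "i \<noteq> h" "j \<noteq> h"
  shows "\<exists>C. C \<noteq> 0 \<and> (\<forall>l\<in>\<Lambda> i. \<forall>m\<in>\<Lambda> j. \<forall>t\<in>\<Lambda> h. l \<inter> m \<subseteq> t \<longrightarrow>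
           (\<forall>b\<in>l. \<forall>x\<in>l. deriv_form (\<Lambda> h) t b x = C * deriv_form (\<Lambda> j) m b x))"
proof -
  have "\<forall>l\<in>\<Lambda> i. \<exists>C. C \<noteq> 0 \<and> (\<forall>m\<in>\<Lambda> j. \<forall>t\<in>\<Lambda> h. l \<inter> m \<subseteq> t \<longrightarrow>
      (\<forall>b\<in>l. \<forall>x\<in>l. deriv_form (\<Lambda> h) t b x = C * deriv_form (\<Lambda> j) m b x))"
    using deriv_form_proportional_on_line[OF net ijh ne] by (rule ballI)
  from bchoice[OF this] obtain C where C: "\<forall>l\<in>\<Lambda> i. C l \<noteq> 0 \<and>
      (\<forall>m\<in>\<Lambda> j. \<forall>t\<in>\<Lambda> h. l \<inter> m \<subseteq> t \<longrightarrow>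
      (\<forall>b\<in>l. \<forall>x\<in>l. deriv_form (\<Lambda> h) t b x = C l * deriv_form (\<Lambda> j) m b x))" ..
  have prod_forms: "deriv_form (\<Lambda> g) m x x = (\<Prod>s\<in>\<Lambda> g. line_form s x)"
    if "g \<in> {1..k}" "m \<in> \<Lambda> g" for g m x
    unfolding deriv_form_def using prod.remove[OF net_component(2)[OF net that(1)] that(2)] by metis
  \<comment> \<open>Taking \<open>b = x\<close> in any matched pair turns the relation between
    derivatives into one between full products, which no longer mentions the pair.\<close>
  have prod_ratio: "(\<Prod>s\<in>\<Lambda> h. line_form s x) = C l * (\<Prod>s\<in>\<Lambda> j. line_form s x)"
    if l: "l \<in> \<Lambda> i" and x: "x \<in> l" for l x
  proof -
    obtain m where m: "m \<in> \<Lambda> j" using net_component(4)[OF net ijh(2)] by blast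
    obtain t where t: "t \<in> \<Lambda> h" "l \<inter> m \<subseteq> t"
      using net_unique_line[OF net ijh(1,2) ne(1) l m ijh(3)] by blast
    have "deriv_form (\<Lambda> h) t x x = C l * deriv_form (\<Lambda> j) m x x"
      using C l m t x by blast
    then show ?thesis
      by (simp only: prod_forms[OF ijh(2) m] prod_forms[OF ijh(3) t(1)])
  qed
  have const: "C l = C l'" if l: "l \<in> \<Lambda> i" "l' \<in> \<Lambda> i" for l l'
  proof (cases "l = l'")
    case False
    obtain x where x: "x \<in> l \<inter> l'" "x \<noteq> 0"
      using point_nonzero inter_lines_in_pg_points[OF _ _ False] net_line[OF net ijh(1)] l by metis
    \<comment> \<open>A line of \<open>\<Lambda> j\<close> through \<open>x\<close> would make
      \<open>x\<close> span a net point lying on two lines of \<open>\<Lambda> i\<close>.\<close>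
    have "x \<notin> s" if "s \<in> \<Lambda> j" for s
      using net_line_through_point[OF net ijh(1,2) ne(1) l(1) that ijh(1) _ x(2) l] x(1) False
      by blast
    then have "(\<Prod>s\<in>\<Lambda> j. line_form s x) \<noteq> 0"
      using net_line[OF net ijh(2)] net_component(2)[OF net ijh(2)] by (simp add: line_form_eq_0_iff)
    moreover have "C l * (\<Prod>s\<in>\<Lambda> j. line_form s x) = C l' * (\<Prod>s\<in>\<Lambda> j. line_form s x)"
      using x(1) trans[OF sym[OF prod_ratio[OF l(1)]] prod_ratio[OF l(2)], of x] by blast
    ultimately show ?thesis by simp
  qed simp
  obtain l where l: "l \<in> \<Lambda> i" using net_component(4)[OF net ijh(1)] by blast
  show ?thesis
  proof (intro exI[of _ "C l"] conjI ballI impI)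
    show "C l \<noteq> 0" using C l by blast
    fix l' m t b x
    assume "l' \<in> \<Lambda> i" "m \<in> \<Lambda> j" "t \<in> \<Lambda> h" "l' \<inter> m \<subseteq> t" "b \<in> l'" "x \<in> l'"
    then show "deriv_form (\<Lambda> h) t b x = C l * deriv_form (\<Lambda> j) m b x"
      unfolding const[OF l \<open>l' \<in> \<Lambda> i\<close>] using C by blast
  qed
qed

section \<open>The cross-ratio at a net point\<close>

theorem proposition3p1:
  fixes \<Lambda> :: "nat \<Rightarrow> ('k::field ^ 3) set set" and n :: nat
  assumes "is_net 4 n \<Lambda>"
  shows "\<exists>\<kappa>. \<forall>P\<in>net_points 4 \<Lambda>.
           \<forall>l1\<in>\<Lambda> 1. \<forall>l2\<in>\<Lambda> 2. \<forall>l3\<in>\<Lambda> 3. \<forall>l4\<in>\<Lambda> 4.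
             P \<subseteq> l1 \<and> P \<subseteq> l2 \<and> P \<subseteq> l3 \<and> P \<subseteq> l4 \<longrightarrow>
             cross_ratio l1 l2 l3 l4 = \<kappa>"
proof -
  note net = assms
  have ix: "1 \<in> {1..4::nat}" "2 \<in> {1..4::nat}" "3 \<in> {1..4::nat}" "4 \<in> {1..4::nat}" by auto
  have C: "\<exists>C. C \<noteq> 0 \<and> (\<forall>l\<in>\<Lambda> i. \<forall>m\<in>\<Lambda> j. \<forall>t\<in>\<Lambda> h. l \<inter> m \<subseteq> t \<longrightarrow>
      (\<forall>b\<in>l. \<forall>x\<in>l. deriv_form (\<Lambda> h) t b x = C * deriv_form (\<Lambda> j) m b x))"
    if "i \<in> {1, 2}" "j \<in> {1, 2}" "i \<noteq> j" "h \<in> {3, 4}" for i j h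
    by (rule deriv_form_proportional[OF net]) (use that in auto)
  \<comment> \<open>Unprimed constants compare along lines of \<open>\<Lambda> 1\<close>, primed
    ones along lines of \<open>\<Lambda> 2\<close>; \<open>c\<close>, \<open>c'\<close> belong to
    \<open>\<Lambda> 3\<close> and \<open>d\<close>, \<open>d'\<close> to
    \<open>\<Lambda> 4\<close>.\<close>
  obtain c where c: "c \<noteq> 0"
    "\<And>l m t b x. l \<in> \<Lambda> 1 \<Longrightarrow> m \<in> \<Lambda> 2 \<Longrightarrow> t \<in> \<Lambda> 3 \<Longrightarrow> l \<inter> m \<subseteq> t \<Longrightarrow> b \<in> l \<Longrightarrow> x \<in> l \<Longrightarrow>
       deriv_form (\<Lambda> 3) t b x = c * deriv_form (\<Lambda> 2) m b x"
    using C[of 1 2 3] by auto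
  obtain c' where c': "c' \<noteq> 0"
    "\<And>l m t b x. l \<in> \<Lambda> 2 \<Longrightarrow> m \<in> \<Lambda> 1 \<Longrightarrow> t \<in> \<Lambda> 3 \<Longrightarrow> l \<inter> m \<subseteq> t \<Longrightarrow> b \<in> l \<Longrightarrow> x \<in> l \<Longrightarrow>
       deriv_form (\<Lambda> 3) t b x = c' * deriv_form (\<Lambda> 1) m b x"
    using C[of 2 1 3] by auto
  obtain d where d: "d \<noteq> 0"
    "\<And>l m t b x. l \<in> \<Lambda> 1 \<Longrightarrow> m \<in> \<Lambda> 2 \<Longrightarrow> t \<in> \<Lambda> 4 \<Longrightarrow> l \<inter> m \<subseteq> t \<Longrightarrow> b \<in> l \<Longrightarrow> x \<in> l \<Longrightarrow>
       deriv_form (\<Lambda> 4) t b x = d * deriv_form (\<Lambda> 2) m b x"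
    using C[of 1 2 4] by auto
  obtain d' where d': "d' \<noteq> 0"
    "\<And>l m t b x. l \<in> \<Lambda> 2 \<Longrightarrow> m \<in> \<Lambda> 1 \<Longrightarrow> t \<in> \<Lambda> 4 \<Longrightarrow> l \<inter> m \<subseteq> t \<Longrightarrow> b \<in> l \<Longrightarrow> x \<in> l \<Longrightarrow>
       deriv_form (\<Lambda> 4) t b x = d' * deriv_form (\<Lambda> 1) m b x"
    using C[of 2 1 4] by auto
  have "cross_ratio l1 l2 l3 l4 = c * d' / (c' * d)"
    if P: "P \<in> net_points 4 \<Lambda>" and l: "l1 \<in> \<Lambda> 1" "l2 \<in> \<Lambda> 2" "l3 \<in> \<Lambda> 3" "l4 \<in> \<Lambda> 4"
      and sub: "P \<subseteq> l1" "P \<subseteq> l2" "P \<subseteq> l3" "P \<subseteq> l4" for P l1 l2 l3 l4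
  proof -
    have Pp: "P \<in> pg_points"
      using P net_inter[OF net] unfolding net_points_def by blast
    obtain p where p: "p \<in> P" "p \<noteq> 0" using point_nonzero[OF Pp] .
    note pg = net_line[OF net ix(1) l(1)] net_line[OF net ix(2) l(2)]
      net_line[OF net ix(3) l(3)] net_line[OF net ix(4) l(4)]
    have dist: "distinct [l1, l2, l3, l4]"
      using net_lines_distinct[OF net ix(1,2) _ l(1,2)] net_lines_distinct[OF net ix(1,3) _ l(1,3)]
        net_lines_distinct[OF net ix(1,4) _ l(1,4)] net_lines_distinct[OF net ix(2,3) _ l(2,3)]
        net_lines_distinct[OF net ix(2,4) _ l(2,4)] net_lines_distinct[OF net ix(3,4) _ l(3,4)]
      by simp
    have P12: "l1 \<inter> l2 \<subseteq> l" if "l \<in> pg_lines" "P \<subseteq> l" for l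
    proof (rule point_subset_line[OF net_inter[OF net ix(1,2) _ l(1,2)] that(1)])
      show "(1::nat) \<noteq> 2" by simp
      show "p \<in> l1 \<inter> l2" "p \<in> l" "p \<noteq> 0" using p sub that(2) by auto
    qed
    have "has_cross_ratio l1 l2 l3 l4 (cross_ratio l1 l2 l3 l4)" (is "has_cross_ratio _ _ _ _ ?\<kappa>")
      unfolding cross_ratio_def
      using cross_ratio_exists_unique[OF pg dist Pp sub] by (rule theI')
    then obtain r w where r: "linear_form r" "l1 = {x. r x = 0}"
      and w: "linear_form w" "l2 = {x. w x = 0}"
      and l3: "l3 = {x. r x + w x = 0}" and l4: "l4 = {x. ?\<kappa> * r x + w x = 0}"
      unfolding has_cross_ratio_def by blast
    interpret r: Vector_Spaces.linear "(*s)" "(*)" r by (rule r)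
    interpret w: Vector_Spaces.linear "(*s)" "(*)" w by (rule w)
    interpret f: Vector_Spaces.linear "(*s)" "(*)" "line_form l3" by (rule linear_line_form[OF pg(3)])
    interpret g: Vector_Spaces.linear "(*s)" "(*)" "line_form l4" by (rule linear_line_form[OF pg(4)])
    \<comment> \<open>Together with \<open>p\<close>, these give directions along \<open>l2\<close>
      and \<open>l1\<close>. The equations of \<open>l3\<close> and \<open>l4\<close> put
      \<open>a - b\<close> and \<open>a - ?\<kappa> *s b\<close> on those lines, which carries the
      cross-ratio over to the chosen forms.\<close>
    obtain a b where ab: "r a = 1" "w a = 0" "r b = 0" "w b = 1"
      using dual_points[OF pg(1,2) _ r w] dist by auto
    have mem: "a \<in> l2" "b \<in> l1" "a \<notin> l1" "b \<notin> l2" using ab r(2) w(2) by auto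
    have "a - b \<in> l3" unfolding l3 using ab by (simp add: r.diff w.diff)
    then have f: "line_form l3 a = line_form l3 b"
      using line_form_eq_0_iff[OF pg(3), of "a - b"] by (simp add: f.diff)
    have "a - ?\<kappa> *s b \<in> l4"
      by (subst l4) (simp add: ab r.diff w.diff r.scale w.scale)
    then have g: "line_form l4 a = ?\<kappa> * line_form l4 b"
      using line_form_eq_0_iff[OF pg(4), of "a - ?\<kappa> *s b"] by (simp add: g.diff g.scale)
    have p12: "p \<in> l1" "p \<in> l2" and s: "l1 \<inter> l2 \<subseteq> l3" "l1 \<inter> l2 \<subseteq> l4" "l2 \<inter> l1 \<subseteq> l3" "l2 \<inter> l1 \<subseteq> l4"
      using p sub P12[OF pg(3) sub(3)] P12[OF pg(4) sub(4)] by auto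
    define A where "A = deriv_form (\<Lambda> 1) l1 a p"
    define B where "B = deriv_form (\<Lambda> 2) l2 b p"
    have A: "A \<noteq> 0" and B: "B \<noteq> 0"
      unfolding A_def B_def
      using deriv_form_nonzero[OF net ix(2,1) _ l(2,1) _ p(2) mem(3)]
        deriv_form_nonzero[OF net ix(1,2) _ l(1,2) _ p(2) mem(4)] p12 by auto
    \<comment> \<open>The derivative is linear in its direction. Direction \<open>a\<close> stays on
      \<open>l2\<close> and is compared with \<open>A\<close>; direction \<open>b\<close> stays on
      \<open>l1\<close> and is compared with \<open>B\<close>.\<close>
    have "deriv_form (\<Lambda> 3) l3 a p = deriv_form (\<Lambda> 3) l3 b p"
      using f by (simp add: deriv_form_def)
    then have 3: "c' * A = c * B"
      using c(2)[OF l(1,2,3) s(1) mem(2) p12(1)] c'(2)[OF l(2,1,3) s(3) mem(1) p12(2)]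
      by (simp add: A_def B_def)
    have "deriv_form (\<Lambda> 4) l4 a p = ?\<kappa> * deriv_form (\<Lambda> 4) l4 b p"
      using g by (simp add: deriv_form_def)
    then have 4: "d' * A = ?\<kappa> * (d * B)"
      using d(2)[OF l(1,2,4) s(2) mem(2) p12(1)] d'(2)[OF l(2,1,4) s(4) mem(1) p12(2)]
      by (simp add: A_def B_def)
    \<comment> \<open>Multiplying the two relations crosswise leaves the common factor
      \<open>A * B\<close>, the only part that depends on the net point.\<close>
    have "?\<kappa> * (c' * d) * (A * B) = c' * A * (?\<kappa> * (d * B))" by (simp add: mult_ac)
    also have "\<dots> = c * B * (d' * A)" by (simp only: 3 4)
    also have "\<dots> = c * d' * (A * B)" by (simp add: mult_ac)
    finally have "?\<kappa> * (c' * d) = c * d'" using A B by simp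
    then show ?thesis using c' d by (simp add: field_simps)
  qed
  then show ?thesis by blast
qed

end
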